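(* Let $\phi$ be an analytic self-map of the upper half-plane $\mathbb{H}$ of parabolic type, i.e. such that $\phi(z)\to\infty$ and $\phi(z)/z\to1$ as $z\to\infty$ non-tangentially. Let $\{w_n=x_n+iy_n\}_{n=0}^{\infty}\subset\mathbb{H}$ be a backward-iteration sequence with bounded steps for $\phi$ which tends to infinity and is of non-zero-height, i.e. such that $y_n\downarrow\ell_\infty>0$, and assume $x_n\to+\infty$. Let $\tau_n(z)=x_n+y_nz$ and let $\psi=\lim_{n\to\infty}\phi_n\circ\tau_n$ be the associated conjugating map. Consider the quadrants $Q(R)=\{x+iy:\ x>R,\ y>1\}$. Then $\psi$ is one-to-one on $Q(R)$ for $R$ large enough, and this is true of $\phi$ as well.
   Context: $\mathbb{H}=\{z\in\mathbb{C}:\operatorname{Im} z>0\}$, and $d(z,w)=\left|\frac{w-z}{w-\overline{z}}\right|$ is the pseudo-hyperbolic distance on $\mathbb{H}$. "$z\to\infty$ non-tangentially" means that $z\to\infty$ within a sector $\{|\operatorname{Arg} z-\pi/2|<\theta_0\}$, for each $\theta_0\in(0,\pi/2)$. A backward-iteration sequence with bounded steps for $\phi$ is a sequence with $\phi(w_{n+1})=w_n$ and $d(w_n,w_{n+1})\le a'<1$ for all $n\ge0$ and some constant $a'$; by Schwarz-Pick $d(w_n,w_{n+1})$ is then non-decreasing, with limit denoted $a<1$. $\downarrow$ denotes non-increasing convergence. $\phi_n$ denotes the $n$-th iterate of $\phi$. It is known (another theorem of the paper) that if such a sequence tends to infinity with $\operatorname{Arg} w_n\to0$, then $\phi_n\circ\tau_n$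 converges uniformly on compact subsets of $\mathbb{H}$ to an analytic self-map $\psi$ of $\mathbb{H}$ with $\psi(z-b_0)=\phi\circ\psi(z)$, where $b_0=\frac{2a}{\sqrt{1-a^2}}=\lim_n\frac{x_{n+1}-x_n}{y_n}$; this is the conjugating map $\psi$ of the claim. *)

theory Defs
  imports "HOL-Complex_Analysis.Complex_Analysis"
begin

definition upper_halfplane :: "complex set" where
  "upper_halfplane = {z. Im z > 0}"

definition pseudo_hyp_dist :: "complex \<Rightarrow> complex \<Rightarrow> real" where
  "pseudo_hyp_dist z w = cmod ((w - z) / (w - cnj z))"

definition analytic_self_map :: "(complex \<Rightarrow> complex) \<Rightarrow> bool" where
  "analytic_self_map \<phi> \<longleftrightarrow>
     \<phi> holomorphic_on upper_halfplane \<and> \<phi> ` upper_halfplane \<subseteq> upper_halfplane"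

definition sector :: "real \<Rightarrow> complex set" where
  "sector \<theta> = {z. \<bar>Arg z - pi / 2\<bar> < \<theta>}"

text \<open>
  Non-tangential limits at infinity: for each opening \<open>\<theta>\<close>, the filter
  \<open>inf at_infinity (principal (sector \<theta>))\<close> describes \<open>z \<rightarrow> \<infinity>\<close> within the sector.
\<close>
definition parabolic_type :: "(complex \<Rightarrow> complex) \<Rightarrow> bool" where
  "parabolic_type \<phi> \<longleftrightarrow> analytic_self_map \<phi> \<and>
     (\<forall>\<theta>\<in>{0<..<pi / 2}.
        filterlim \<phi> at_infinity (inf at_infinity (principal (sector \<theta>))) \<and>
        ((\<lambda>z. \<phi> z / z) \<longlongrightarrow> 1) (inf at_infinity (principal (sector \<theta>))))"

definition backward_iteration_bounded_steps ::
    "(complex \<Rightarrow> complex) \<Rightarrow> (nat \<Rightarrow> complex) \<Rightarrow> bool" where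
  "backward_iteration_bounded_steps \<phi> w \<longleftrightarrow>
     (\<forall>n. w n \<in> upper_halfplane) \<and>
     (\<forall>n. \<phi> (w (Suc n)) = w n) \<and>
     (\<exists>a'<1. \<forall>n. pseudo_hyp_dist (w n) (w (Suc n)) \<le> a')"

definition nonzero_height :: "(nat \<Rightarrow> complex) \<Rightarrow> bool" where
  "nonzero_height w \<longleftrightarrow>
     decseq (\<lambda>n. Im (w n)) \<and> (\<exists>l>0. (\<lambda>n. Im (w n)) \<longlonglongrightarrow> l)"

definition renorm_map :: "(nat \<Rightarrow> complex) \<Rightarrow> nat \<Rightarrow> complex \<Rightarrow> complex" where
  "renorm_map w n z = of_real (Re (w n)) + of_real (Im (w n)) * z"

text \<open>
  The conjugating map, as the pointwise limit of \<open>\<phi>\<^sub>n \<circ> \<tau>\<^sub>n\<close>.  When \<open>\<phi>\<close> is of parabolic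
  type and \<open>w\<close> is a backward-iteration sequence with bounded steps tending to infinity with
  \<open>Arg (w n) \<longlonglongrightarrow> 0\<close>, the convergence is locally uniform on the half-plane; elsewhere the
  value of \<^const>\<open>lim\<close> carries no meaning.
\<close>
definition conjugating_map ::
    "(complex \<Rightarrow> complex) \<Rightarrow> (nat \<Rightarrow> complex) \<Rightarrow> complex \<Rightarrow> complex" where
  "conjugating_map \<phi> w z = lim (\<lambda>n. (\<phi> ^^ n) (renorm_map w n z))"

definition quadrant :: "real \<Rightarrow> complex set" where
  "quadrant R = {z. Re z > R \<and> Im z > 1}"

end

theory Submission
  imports Defs
begin

text \<open>
  The two-point form of the Schwarz--Pick inequality,
  \<open>|f z - f w|\<^sup>2 \<le> |z - w|\<^sup>2 (Im f z / Im z) (Im f w / Im w)\<close>, survives pointwise limits and so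
  spares all derivatives.  It gives a Harnack inequality for \<open>Im f\<close>, shows that \<open>Im f / Im z\<close>
  decreases along upward vertical lines, and makes \<open>c z + f z\<close> injective wherever
  \<open>Im f z < c Im z\<close>.  This applies to \<open>\<phi> z = z + p z\<close>, where \<open>Im p \<ge> 0\<close> by Julia's lemma, and to
  \<open>\<psi> z = l z + q z\<close> with \<open>l = lim y\<^sub>n\<close>: both \<open>Im p\<close> and \<open>Im q\<close> are small at a sequence of
  points marching to the right with bounded gaps at bounded height, hence by Harnack on the line
  \<open>Im z = 1\<close> far to the right, and by monotonicity on a whole quadrant.
\<close>

section \<open>Schwarz-Pick inequality on the half-plane\<close>

lemma cayley_cmod_less_1:
  assumes "0 < Im z" "0 < Im a"
  shows "cmod ((z - a) / (z - cnj a)) < 1"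
proof -
  have "(cmod (z - a))\<^sup>2 < (cmod (z - cnj a))\<^sup>2"
    using mult_pos_pos[OF assms] unfolding cmod_power2 by (simp add: power2_eq_square algebra_simps)
  then have "cmod (z - a) < cmod (z - cnj a)"
    by (rule power_less_imp_less_base) simp
  then show ?thesis
    by (simp add: norm_divide divide_less_eq)
qed

text \<open>The quotient is the inverse of the Cayley transform that sends \<open>a\<close> to 0;
  multiplying by the conjugate of the denominator exposes its imaginary part.\<close>

lemma Im_cayley_inverse_pos:
  assumes "cmod \<zeta> < 1" "0 < Im a"
  shows "0 < Im ((a - cnj a * \<zeta>) / (1 - \<zeta>))"
proof -
  have "\<zeta> \<noteq> 1" using assms(1) by auto
  have "Im ((a - cnj a * \<zeta>) * cnj (1 - \<zeta>)) = Im a * (1 - (cmod \<zeta>)\<^sup>2)"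
    unfolding cmod_power2 by (simp add: power2_eq_square algebra_simps)
  moreover have "(cmod \<zeta>)\<^sup>2 < 1"
    using assms(1) by (simp add: power_less_one_iff)
  ultimately have "0 < Im ((a - cnj a * \<zeta>) * cnj (1 - \<zeta>))"
    using assms(2) by simp
  then show ?thesis
    using \<open>\<zeta> \<noteq> 1\<close> by (subst complex_div_cnj) (simp flip: of_real_power)
qed

text \<open>Cayley transforms centred at \<open>a\<close> in the source and at \<open>f a\<close> in
  the target turn \<open>f\<close> into a self-map of the disc fixing 0, to which the Schwarz lemma
  applies.\<close>

lemma schwarz_pick_halfplane:
  assumes hol: "f holomorphic_on upper_halfplane" and sub: "f ` upper_halfplane \<subseteq> upper_halfplane"
    and a: "a \<in> upper_halfplane" and z: "z \<in> upper_halfplane"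
  shows "cmod ((f z - f a) / (f z - cnj (f a))) \<le> cmod ((z - a) / (z - cnj a))"
proof -
  define g where "g \<zeta> = (a - cnj a * \<zeta>) / (1 - \<zeta>)" for \<zeta>
  define h where "h \<zeta> = (f (g \<zeta>) - f a) / (f (g \<zeta>) - cnj (f a))" for \<zeta>
  have fpos: "0 < Im (f v)" if "0 < Im v" for v
    using sub that by (auto simp: upper_halfplane_def)
  have Ia: "0 < Im a" and Iz: "0 < Im z"
    using a z by (auto simp: upper_halfplane_def)
  have gpos: "0 < Im (g \<zeta>)" if "cmod \<zeta> < 1" for \<zeta>
    unfolding g_def using that Ia by (rule Im_cayley_inverse_pos)
  have ne: "v - cnj u \<noteq> 0" if "0 < Im u" "0 < Im v" for u v
    using that by (auto simp: complex_eq_iff)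
  have "g holomorphic_on ball 0 1"
    unfolding g_def by (intro holomorphic_intros) auto
  moreover have "g ` ball 0 1 \<subseteq> upper_halfplane"
    using gpos by (auto simp: upper_halfplane_def)
  ultimately have "(f \<circ> g) holomorphic_on ball 0 1"
    using hol holomorphic_on_compose_gen by blast
  then have "h holomorphic_on ball 0 1"
    unfolding h_def o_def using ne fpos Ia gpos by (intro holomorphic_intros) auto
  moreover have "h 0 = 0"
    by (simp add: h_def g_def)
  moreover have "cmod (h \<zeta>) < 1" if "cmod \<zeta> < 1" for \<zeta>
    unfolding h_def using fpos gpos that Ia by (intro cayley_cmod_less_1) auto
  moreover have "cmod ((z - a) / (z - cnj a)) < 1"
    using Iz Ia by (rule cayley_cmod_less_1)
  ultimately have "cmod (h ((z - a) / (z - cnj a))) \<le> cmod ((z - a) / (z - cnj a))"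
    by (rule Schwarz_Lemma(1))
  moreover have "g ((z - a) / (z - cnj a)) = z"
  proof -
    have "a - cnj a \<noteq> 0" "z - cnj a \<noteq> 0" using ne Ia Iz by auto
    moreover have "1 - (z - a) / (z - cnj a) = (a - cnj a) / (z - cnj a)"
      using calculation by (simp add: field_simps)
    moreover have "a - cnj a * ((z - a) / (z - cnj a)) = z * (a - cnj a) / (z - cnj a)"
      using calculation by (simp add: field_simps)
    ultimately show ?thesis
      unfolding g_def by simp
  qed
  ultimately show ?thesis
    by (simp add: h_def)
qed

section \<open>Two-point Pick inequality and its consequences\<close>

text \<open>
  With \<open>d\<close> the pseudo-hyperbolic distance, \<open>4 d\<^sup>2 / (1 - d\<^sup>2)\<close>.  In this form the Schwarz--Pick
  inequality makes sense for maps into the closed half-plane.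
\<close>
definition hyp_sep :: "complex \<Rightarrow> complex \<Rightarrow> real" where
  "hyp_sep z w = (cmod (z - w))\<^sup>2 / (Im z * Im w)"

text \<open>Holomorphy is left out so that the class is closed under pointwise limits. The closed
  half-plane is allowed because displacements such as that of a horizontal translation may be
  real.\<close>

definition pick_map :: "(complex \<Rightarrow> complex) \<Rightarrow> bool" where
  "pick_map f \<longleftrightarrow>
     (\<forall>z\<in>upper_halfplane. 0 \<le> Im (f z)) \<and>
     (\<forall>z\<in>upper_halfplane. \<forall>w\<in>upper_halfplane.
        (cmod (f z - f w))\<^sup>2 \<le> hyp_sep z w * (Im (f z) * Im (f w)))"

lemma hyp_sep_nonneg: "z \<in> upper_halfplane \<Longrightarrow> w \<in> upper_halfplane \<Longrightarrow> 0 \<le> hyp_sep z w"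
  by (simp add: hyp_sep_def upper_halfplane_def)

lemma pick_mapD:
  assumes "pick_map f" "z \<in> upper_halfplane" "w \<in> upper_halfplane"
  shows "(cmod (f z - f w))\<^sup>2 \<le> hyp_sep z w * (Im (f z) * Im (f w))"
  using assms by (auto simp: pick_map_def)

lemma pick_map_Im_nonneg: "pick_map f \<Longrightarrow> z \<in> upper_halfplane \<Longrightarrow> 0 \<le> Im (f z)"
  by (simp add: pick_map_def)

lemma cmod_minus_cnj_power2: "(cmod (z - cnj a))\<^sup>2 = (cmod (z - a))\<^sup>2 + 4 * (Im z * Im a)"
  unfolding cmod_power2 by (simp add: power2_eq_square algebra_simps)

text \<open>The function t / (t + 4) is increasing for nonnegative t, and it takes
  \<open>hyp_sep\<close> to the squared pseudo-hyperbolic distance.\<close>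

lemma divide_add_le_divide_add_iff:
  fixes A B C D :: real
  assumes "0 \<le> A" "0 < B" "0 \<le> C" "0 < D"
  shows "A / (A + 4 * B) \<le> C / (C + 4 * D) \<longleftrightarrow> A \<le> C / D * B"
  using assms by (simp add: field_simps add_pos_nonneg add_nonneg_pos)

text \<open>Raising \<open>f\<close> by a small height e > 0 puts its values in the open half-plane,
  where Schwarz-Pick applies; then e tends to 0.\<close>

lemma holomorphic_imp_pick_map:
  assumes hol: "f holomorphic_on upper_halfplane"
    and nonneg: "\<And>z. z \<in> upper_halfplane \<Longrightarrow> 0 \<le> Im (f z)"
  shows "pick_map f"
  unfolding pick_map_def
proof (intro conjI ballI)
  fix z w assume zw: "z \<in> upper_halfplane" "w \<in> upper_halfplane"
  then have pos: "0 < Im z * Im w" by (simp add: upper_halfplane_def)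
  have "(cmod (f z - f w))\<^sup>2 \<le> hyp_sep z w * ((Im (f z) + e) * (Im (f w) + e))" if "e > 0" for e
  proof -
    define g where "g v = f v + \<i> * of_real e" for v
    have Ig: "0 < Im (g v)" if "v \<in> upper_halfplane" for v
      using nonneg[OF that] \<open>e > 0\<close> by (simp add: g_def)
    have "cmod ((g z - g w) / (g z - cnj (g w))) \<le> cmod ((z - w) / (z - cnj w))"
    proof (rule schwarz_pick_halfplane)
      show "g holomorphic_on upper_halfplane"
        unfolding g_def by (intro holomorphic_intros hol)
      show "g ` upper_halfplane \<subseteq> upper_halfplane"
        using Ig by (auto simp: upper_halfplane_def)
    qed (use zw in auto)
    then have "(cmod ((g z - g w) / (g z - cnj (g w))))\<^sup>2 \<le> (cmod ((z - w) / (z - cnj w)))\<^sup>2"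
      by (rule power_mono) simp
    then have "(cmod (g z - g w))\<^sup>2 \<le> hyp_sep z w * (Im (g z) * Im (g w))"
      using Ig zw pos
      by (simp add: norm_divide power_divide cmod_minus_cnj_power2 divide_add_le_divide_add_iff hyp_sep_def)
    then show ?thesis by (simp add: g_def)
  qed
  then have "\<forall>\<^sub>F e in at_right 0.
      (cmod (f z - f w))\<^sup>2 \<le> hyp_sep z w * ((Im (f z) + e) * (Im (f w) + e))"
    by (auto simp: eventually_at_filter)
  moreover have "((\<lambda>e. hyp_sep z w * ((Im (f z) + e) * (Im (f w) + e))) \<longlongrightarrow>
      hyp_sep z w * ((Im (f z) + 0) * (Im (f w) + 0))) (at_right 0)"
    by (intro tendsto_intros)
  ultimately show "(cmod (f z - f w))\<^sup>2 \<le> hyp_sep z w * (Im (f z) * Im (f w))"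
    using tendsto_lowerbound by fastforce
qed (rule nonneg)

lemma pick_map_limit:
  assumes "\<And>n. pick_map (f n)"
    and lim: "\<And>z. z \<in> upper_halfplane \<Longrightarrow> (\<lambda>n. f n z) \<longlonglongrightarrow> g z"
  shows "pick_map g"
  unfolding pick_map_def
proof (intro conjI ballI)
  fix z assume z: "z \<in> upper_halfplane"
  show "0 \<le> Im (g z)"
    by (rule LIMSEQ_le_const[OF tendsto_Im[OF lim[OF z]]]) (use assms(1) z pick_map_Im_nonneg in blast)
next
  fix z w assume zw: "z \<in> upper_halfplane" "w \<in> upper_halfplane"
  show "(cmod (g z - g w))\<^sup>2 \<le> hyp_sep z w * (Im (g z) * Im (g w))"
  proof (rule LIMSEQ_le)
    show "(\<lambda>n. (cmod (f n z - f n w))\<^sup>2) \<longlonglongrightarrow> (cmod (g z - g w))\<^sup>2"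
      "(\<lambda>n. hyp_sep z w * (Im (f n z) * Im (f n w))) \<longlonglongrightarrow> hyp_sep z w * (Im (g z) * Im (g w))"
      by (intro tendsto_intros lim zw)+
  qed (use pick_mapD[OF assms(1) zw] in auto)
qed

text \<open>With u, v the two imaginary parts and t the separation, the Pick inequality contains (u
  - v)^2 <= t u v, so u^2 + v^2 <= (2 + t) u v; drop v^2 and divide by u.\<close>

lemma pick_map_harnack:
  assumes f: "pick_map f" and z: "z \<in> upper_halfplane" and w: "w \<in> upper_halfplane"
  shows "Im (f z) \<le> (2 + hyp_sep z w) * Im (f w)"
proof -
  let ?u = "Im (f z)" and ?v = "Im (f w)" and ?t = "hyp_sep z w"
  have nonneg: "0 \<le> ?u" "0 \<le> ?v" "0 \<le> ?t"
    using pick_map_Im_nonneg[OF f] hyp_sep_nonneg z w by auto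
  have "\<bar>Im (f z - f w)\<bar>\<^sup>2 \<le> (cmod (f z - f w))\<^sup>2"
    by (rule power_mono[OF abs_Im_le_cmod]) simp
  also have "\<dots> \<le> ?t * (?u * ?v)"
    using f z w by (rule pick_mapD)
  finally have "?u * ?u + ?v * ?v \<le> ?u * ((2 + ?t) * ?v)"
    by (simp add: power2_eq_square algebra_simps)
  then have "?u * ?u \<le> ?u * ((2 + ?t) * ?v)"
    using nonneg by (smt (verit) mult_nonneg_nonneg)
  then show ?thesis
    using nonneg by (cases "?u = 0") auto
qed

text \<open>Harnack eliminates \<open>Im (f z)\<close> from the Pick inequality, so smallness of
  \<open>Im f\<close> at one point bounds the full complex difference.\<close>

lemma pick_map_cmod_diff_le:
  assumes f: "pick_map f" and z: "z \<in> upper_halfplane" and w: "w \<in> upper_halfplane"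
  shows "cmod (f z - f w) \<le> (2 + hyp_sep z w) * Im (f w)"
proof (rule power2_le_imp_le)
  let ?t = "hyp_sep z w"
  have nonneg: "0 \<le> Im (f z)" "0 \<le> Im (f w)" "0 \<le> ?t"
    using pick_map_Im_nonneg[OF f] hyp_sep_nonneg z w by auto
  have "(cmod (f z - f w))\<^sup>2 \<le> ?t * (Im (f z) * Im (f w))"
    using f z w by (rule pick_mapD)
  also have "\<dots> \<le> (2 + ?t) * (((2 + ?t) * Im (f w)) * Im (f w))"
    using pick_map_harnack[OF f z w] nonneg by (intro mult_mono) auto
  finally show "(cmod (f z - f w))\<^sup>2 \<le> ((2 + ?t) * Im (f w))\<^sup>2"
    by (simp add: power2_eq_square mult_ac)
  show "0 \<le> (2 + ?t) * Im (f w)"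
    using nonneg by simp
qed

text \<open>With p, q the ratios at heights a, b, the Pick inequality on a vertical line reads (q b
  - p a)^2 <= (b - a)^2 q p. If p < q, this forces q b - p a <= (b - a) q, that is q <= p.\<close>

lemma pick_map_Im_ratio_antimono:
  assumes f: "pick_map f" and a: "0 < a" and ab: "a \<le> b"
  shows "Im (f (Complex x b)) / b \<le> Im (f (Complex x a)) / a"
proof (rule ccontr)
  define p q where "p = Im (f (Complex x a)) / a" and "q = Im (f (Complex x b)) / b"
  assume "\<not> ?thesis"
  then have less: "p < q" by (simp add: p_def q_def)
  have H: "Complex x a \<in> upper_halfplane" "Complex x b \<in> upper_halfplane"
    using a ab by (auto simp: upper_halfplane_def)
  have p: "0 \<le> p"
    unfolding p_def using pick_map_Im_nonneg[OF f H(1)] a by simp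
  have pq: "Im (f (Complex x a)) = p * a" "Im (f (Complex x b)) = q * b"
    using a ab by (auto simp: p_def q_def)
  have "Complex x b - Complex x a = \<i> * of_real (b - a)"
    by (simp add: complex_eq_iff)
  then have "(cmod (Complex x b - Complex x a))\<^sup>2 = (b - a)\<^sup>2"
    by (simp add: norm_mult del: of_real_diff)
  then have sep: "hyp_sep (Complex x b) (Complex x a) = (b - a)\<^sup>2 / (b * a)"
    by (simp add: hyp_sep_def)
  have "\<bar>Im (f (Complex x b) - f (Complex x a))\<bar>\<^sup>2 \<le> (cmod (f (Complex x b) - f (Complex x a)))\<^sup>2"
    by (rule power_mono[OF abs_Im_le_cmod]) simp
  also have "\<dots> \<le> (b - a)\<^sup>2 / (b * a) * ((q * b) * (p * a))"
    using pick_mapD[OF f H(2) H(1)] by (simp add: sep pq)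
  finally have "(q * b - p * a)\<^sup>2 \<le> (b - a)\<^sup>2 * (q * p)"
    using a ab by (simp add: pq)
  also have "\<dots> \<le> (b - a)\<^sup>2 * q\<^sup>2"
    using less p by (simp add: mult_left_mono power2_eq_square)
  finally have "(q * b - p * a)\<^sup>2 \<le> ((b - a) * q)\<^sup>2"
    by (simp add: power_mult_distrib)
  then have "q * b - p * a \<le> (b - a) * q"
    by (rule power2_le_imp_le) (use ab less p in auto)
  then show False
    using a less by (simp add: algebra_simps)
qed

lemma pick_map_Im_less_on_quadrant:
  assumes f: "pick_map f"
    and line: "\<And>x. x > R \<Longrightarrow> Im (f (Complex x 1)) < c"
    and z: "z \<in> quadrant R"
  shows "Im (f z) < c * Im z"
proof -
  have "Re z > R" "1 < Im z" using z by (auto simp: quadrant_def)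
  then have "Im (f z) / Im z < c"
    using pick_map_Im_ratio_antimono[OF f, of 1 "Im z" "Re z"] line[of "Re z"] by simp
  then show ?thesis
    using \<open>1 < Im z\<close> by (simp add: field_simps)
qed

text \<open>A collision of two distinct points would give |f z - f w| = c |z - w|, while the Pick
  inequality with both imaginary parts below c times the height makes it strictly smaller.\<close>

lemma inj_on_linear_plus_pick_map:
  assumes f: "pick_map f" and c: "0 < c"
    and S: "S \<subseteq> upper_halfplane"
    and small: "\<And>z. z \<in> S \<Longrightarrow> Im (f z) < c * Im z"
  shows "inj_on (\<lambda>z. of_real c * z + f z) S"
proof (rule inj_onI, rule ccontr)
  fix z w assume zw: "z \<in> S" "w \<in> S" and "of_real c * z + f z = of_real c * w + f w" and "z \<noteq> w"
  then have "f z - f w = of_real c * (w - z)" by (simp add: algebra_simps)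
  then have "(cmod (f z - f w))\<^sup>2 = c\<^sup>2 * (cmod (z - w))\<^sup>2"
    by (simp add: norm_mult power_mult_distrib norm_minus_commute)
  moreover have H: "z \<in> upper_halfplane" "w \<in> upper_halfplane" using zw S by auto
  ultimately have *: "c\<^sup>2 * (cmod (z - w))\<^sup>2 \<le> hyp_sep z w * (Im (f z) * Im (f w))"
    using pick_mapD[OF f] by metis
  have pos: "0 < Im z" "0 < Im w" using H by (auto simp: upper_halfplane_def)
  then have "0 < hyp_sep z w"
    using \<open>z \<noteq> w\<close> by (simp add: hyp_sep_def)
  then have "hyp_sep z w * (Im (f z) * Im (f w)) < hyp_sep z w * ((c * Im z) * (c * Im w))"
    using small[OF zw(1)] small[OF zw(2)] pick_map_Im_nonneg[OF f H(1)] pick_map_Im_nonneg[OF f H(2)]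
    by (intro mult_strict_left_mono mult_strict_mono') auto
  also have "\<dots> = c\<^sup>2 * (cmod (z - w))\<^sup>2"
    using pos by (simp add: hyp_sep_def power2_eq_square)
  finally show False using * by simp
qed

section \<open>Julia's inequality for parabolic type\<close>

text \<open>Julia's lemma with angular derivative 1: let one of the two points of the Schwarz--Pick
  inequality tend to infinity along the imaginary axis.\<close>
lemma parabolic_type_Im_ge:
  assumes "parabolic_type \<phi>" and z: "z \<in> upper_halfplane"
  shows "Im z \<le> Im (\<phi> z)"
proof -
  have hol: "\<phi> holomorphic_on upper_halfplane" and sub: "\<phi> ` upper_halfplane \<subseteq> upper_halfplane"
    and lim: "((\<lambda>z. \<phi> z / z) \<longlongrightarrow> 1) (inf at_infinity (principal (sector (pi / 4))))"
    using assms(1) pi_gt_zero by (auto simp: parabolic_type_def analytic_self_map_def)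
  have pick: "pick_map \<phi>"
    using hol sub by (intro holomorphic_imp_pick_map) (auto simp: upper_halfplane_def image_subset_iff less_imp_le)
  have inf: "filterlim (\<lambda>Y. \<i> * complex_of_real Y) at_infinity at_top"
    by (rule filterlim_norm_at_top_imp_at_infinity) (simp add: norm_mult filterlim_abs_real)
  have "Arg (\<i> * complex_of_real Y) = pi / 2" if "Y > 0" for Y
    using that by (metis Arg_ii Arg_times_of_real2)
  then have "\<forall>\<^sub>F Y in at_top. \<i> * complex_of_real Y \<in> sector (pi / 4)"
    by (intro eventually_mono[OF eventually_gt_at_top[of 0]]) (simp add: sector_def)
  then have "filterlim (\<lambda>Y. \<i> * complex_of_real Y)
      (inf at_infinity (principal (sector (pi / 4)))) at_top"
    using inf by (simp add: filterlim_inf filterlim_principal)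
  then have "((\<lambda>Y. \<phi> (\<i> * of_real Y) / (\<i> * of_real Y)) \<longlongrightarrow> 1) at_top"
    by (rule filterlim_compose[OF lim])
  then have "((\<lambda>Y. \<i> * (\<phi> (\<i> * of_real Y) / (\<i> * of_real Y))) \<longlongrightarrow> \<i> * 1) at_top"
    by (intro tendsto_intros)
  then have L: "((\<lambda>Y. \<phi> (\<i> * of_real Y) / of_real Y) \<longlongrightarrow> \<i>) at_top"
    by simp
  have const: "((\<lambda>Y. c / complex_of_real Y) \<longlongrightarrow> 0) at_top" for c
    by (rule tendsto_divide_0[OF tendsto_const])
       (rule filterlim_norm_at_top_imp_at_infinity, simp add: filterlim_abs_real)
  \<comment> \<open>This is the limit of the Pick inequality at \<open>z\<close> and at the point of
    height Y on the imaginary axis, multiplied by \<open>Im z\<close> and divided by Y^2.\<close>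
  have "(cmod (\<i> - 0))\<^sup>2 * Im z \<le> (cmod (0 - \<i>))\<^sup>2 * (Im (\<phi> z) * Im \<i>)"
  proof (rule tendsto_le[OF trivial_limit_at_top_linorder])
    show "((\<lambda>Y. (cmod (\<phi> (\<i> * of_real Y) / of_real Y - \<phi> z / of_real Y))\<^sup>2 * Im z) \<longlongrightarrow>
        (cmod (\<i> - 0))\<^sup>2 * Im z) at_top"
      by (intro tendsto_intros L const)
    show "((\<lambda>Y. (cmod (z / of_real Y - \<i>))\<^sup>2 * (Im (\<phi> z) * Im (\<phi> (\<i> * of_real Y) / of_real Y))) \<longlongrightarrow>
        (cmod (0 - \<i>))\<^sup>2 * (Im (\<phi> z) * Im \<i>)) at_top"
      by (intro tendsto_intros L const)
    show "\<forall>\<^sub>F Y in at_top. (cmod (\<phi> (\<i> * of_real Y) / of_real Y - \<phi> z / of_real Y))\<^sup>2 * Im z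
        \<le> (cmod (z / of_real Y - \<i>))\<^sup>2 * (Im (\<phi> z) * Im (\<phi> (\<i> * of_real Y) / of_real Y))"
      using eventually_gt_at_top[of "0::real"]
    proof eventually_elim
      case (elim Y)
      let ?v = "\<i> * complex_of_real Y"
      have v: "?v \<in> upper_halfplane" using elim by (simp add: upper_halfplane_def)
      have Iz: "0 < Im z" using z by (simp add: upper_halfplane_def)
      have 1: "cmod (\<phi> ?v / of_real Y - \<phi> z / of_real Y) = cmod (\<phi> z - \<phi> ?v) / Y"
        using elim by (simp add: norm_divide norm_minus_commute flip: diff_divide_distrib)
      have "z / of_real Y - \<i> = (z - ?v) / of_real Y"
        using elim by (simp add: diff_divide_distrib)
      then have 2: "cmod (z / of_real Y - \<i>) = cmod (z - ?v) / Y"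
        using elim by (simp add: norm_divide)
      have "(cmod (\<phi> z - \<phi> ?v))\<^sup>2 \<le> hyp_sep z ?v * (Im (\<phi> z) * Im (\<phi> ?v))"
        using pick z v by (rule pick_mapD)
      then show ?case
        unfolding 1 2 using elim Iz by (simp add: hyp_sep_def field_simps power2_eq_square)
    qed
  qed
  then show ?thesis by simp
qed

section \<open>Nearby orbit points and renormalisation\<close>

text \<open>A discrete intermediate value argument: take the first index from m on at which s
  reaches X. The preceding term is still below X, so the overshoot is at most one step.\<close>

lemma exists_close_term:
  fixes s :: "nat \<Rightarrow> real"
  assumes lim: "filterlim s at_top sequentially"
    and step: "\<And>k. \<bar>s (Suc k) - s k\<bar> \<le> B" and start: "s m \<le> X"
  shows "\<exists>k\<ge>m. \<bar>X - s k\<bar> \<le> B"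
proof -
  have "\<forall>\<^sub>F k in sequentially. X \<le> s k"
    using lim by (simp add: filterlim_at_top)
  then have "\<exists>k. X \<le> s (m + k)"
    unfolding eventually_sequentially using le_add2 by blast
  then obtain k where k: "X \<le> s (m + k)" and least: "\<And>j. j < k \<Longrightarrow> s (m + j) < X"
    using exists_least_iff[of "\<lambda>k. X \<le> s (m + k)"] by (auto simp: not_le)
  show ?thesis
  proof (cases k)
    case 0
    \<comment> \<open>Here s m = X, and the step bound serves only to give 0 <= B.\<close>
    then show ?thesis using k start step[of m] by (intro exI[of _ m]) auto
  next
    case (Suc j)
    then show ?thesis
      using k least[of j] step[of "m + j"] by (intro exI[of _ "m + k"]) auto
  qed
qed

lemma hyp_sep_le:
  assumes "0 < a" "0 < b" "a \<le> Im z" "b \<le> Im w" "cmod (z - w) \<le> C"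
  shows "hyp_sep z w \<le> C\<^sup>2 / (a * b)"
  unfolding hyp_sep_def using assms by (intro frac_le power_mono mult_mono mult_pos_pos) auto

text \<open>The renormalisation is a real translation after a real dilation, hence a hyperbolic
  isometry.\<close>

lemma hyp_sep_renorm_map:
  assumes "Im (w n) \<noteq> 0"
  shows "hyp_sep (renorm_map w n z) (renorm_map w n v) = hyp_sep z v"
proof -
  have "renorm_map w n z - renorm_map w n v = of_real (Im (w n)) * (z - v)"
    by (simp add: renorm_map_def algebra_simps)
  then show ?thesis
    using assms by (simp add: hyp_sep_def norm_mult power_mult_distrib) (simp add: renorm_map_def power2_eq_square)
qed

lemma renorm_map_ii: "renorm_map w n \<i> = w n"
  by (simp add: renorm_map_def complex_eq_iff)

lemma Im_renorm_map: "Im (renorm_map w n z) = Im (w n) * Im z"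
  by (simp add: renorm_map_def)

section \<open>Iterates and displacements along the backward orbit\<close>

locale parabolic_backward_orbit =
  fixes \<phi> :: "complex \<Rightarrow> complex" and w :: "nat \<Rightarrow> complex" and l :: real
  assumes parabolic: "parabolic_type \<phi>"
    and backward: "backward_iteration_bounded_steps \<phi> w"
    and height_decseq: "decseq (\<lambda>n. Im (w n))"
    and height_pos: "0 < l"
    and height_lim: "(\<lambda>n. Im (w n)) \<longlonglongrightarrow> l"
    and Re_lim: "filterlim (\<lambda>n. Re (w n)) at_top sequentially"
begin

lemma orbit_in_halfplane: "w n \<in> upper_halfplane"
  using backward by (simp add: backward_iteration_bounded_steps_def)

lemma orbit_step: "\<phi> (w (Suc n)) = w n"
  using backward by (simp add: backward_iteration_bounded_steps_def)

lemma Im_orbit_bounds: "l \<le> Im (w n)" "Im (w n) \<le> Im (w 0)"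
  using decseq_ge[OF height_decseq height_lim] height_decseq by (auto simp: decseq_def)

lemma holomorphic: "\<phi> holomorphic_on upper_halfplane"
  and maps: "z \<in> upper_halfplane \<Longrightarrow> \<phi> z \<in> upper_halfplane"
  using parabolic by (auto simp: parabolic_type_def analytic_self_map_def)

lemma funpow_in_halfplane: "z \<in> upper_halfplane \<Longrightarrow> (\<phi> ^^ n) z \<in> upper_halfplane"
  by (induction n) (auto intro: maps)

lemma funpow_holomorphic: "(\<phi> ^^ n) holomorphic_on upper_halfplane"
proof (induction n)
  case 0
  show ?case by (simp add: id_def)
next
  case (Suc n)
  then show ?case
    unfolding funpow.simps using holomorphic funpow_in_halfplane
    by (intro holomorphic_on_compose_gen) auto
qed

lemma funpow_Im_ge: "z \<in> upper_halfplane \<Longrightarrow> Im z \<le> Im ((\<phi> ^^ n) z)"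
proof (induction n)
  case (Suc n)
  then show ?case
    using parabolic_type_Im_ge[OF parabolic funpow_in_halfplane[OF Suc.prems], of n] by simp
qed simp

lemma funpow_orbit: "(\<phi> ^^ n) (w (n + k)) = w k"
  by (induction n) (simp_all add: funpow_swap1 orbit_step)

lemma pick_map_displacement: "pick_map (\<lambda>z. \<phi> z - z)"
  using parabolic_type_Im_ge[OF parabolic] holomorphic
  by (intro holomorphic_imp_pick_map holomorphic_intros) auto

lemma pick_map_funpow: "pick_map (\<phi> ^^ n)"
  using funpow_in_halfplane by (intro holomorphic_imp_pick_map funpow_holomorphic)
    (auto simp: upper_halfplane_def less_imp_le)

lemma renorm_map_in_halfplane: "z \<in> upper_halfplane \<Longrightarrow> renorm_map w n z \<in> upper_halfplane"
  using orbit_in_halfplane[of n] by (simp add: upper_halfplane_def Im_renorm_map)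

lemma funpow_renorm_holomorphic:
  "(\<lambda>z. (\<phi> ^^ n) (renorm_map w n z)) holomorphic_on upper_halfplane"
proof -
  have "renorm_map w n holomorphic_on upper_halfplane"
    unfolding renorm_map_def [abs_def] by (intro holomorphic_intros)
  then have "((\<phi> ^^ n) \<circ> renorm_map w n) holomorphic_on upper_halfplane"
    using funpow_holomorphic renorm_map_in_halfplane
    by (intro holomorphic_on_compose_gen) auto
  then show ?thesis by (simp add: o_def)
qed

lemma pick_map_funpow_renorm: "pick_map (\<lambda>z. (\<phi> ^^ n) (renorm_map w n z))"
  using funpow_in_halfplane[OF renorm_map_in_halfplane]
  by (intro holomorphic_imp_pick_map funpow_renorm_holomorphic)
     (auto simp: upper_halfplane_def less_imp_le)

text \<open>Iterated Julia inequality: the iterates do not lower the height of the renormalised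
  point, which is \<open>Im (w n) * Im z\<close>.\<close>

lemma pick_map_renorm_displacement:
  "pick_map (\<lambda>z. (\<phi> ^^ n) (renorm_map w n z) - of_real (Im (w n)) * z)"
  using funpow_Im_ge[OF renorm_map_in_halfplane]
  by (intro holomorphic_imp_pick_map holomorphic_intros funpow_renorm_holomorphic)
     (auto simp: Im_renorm_map)

text \<open>Bounded hyperbolic steps at bounded height are bounded Euclidean steps.\<close>

lemma bounded_steps: "\<exists>B. \<forall>n. \<bar>Re (w (Suc n)) - Re (w n)\<bar> \<le> B"
proof -
  obtain a where a: "a < 1" "\<And>n. pseudo_hyp_dist (w n) (w (Suc n)) \<le> a"
    using backward by (auto simp: backward_iteration_bounded_steps_def)
  have a0: "0 \<le> a" using a(2)[of 0] by (rule order_trans[rotated]) (simp add: pseudo_hyp_dist_def)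
  have a2: "a\<^sup>2 < 1" using a(1) a0 by (simp add: power_less_one_iff)
  \<comment> \<open>Obtained by solving d <= a^2 (d + 4 y^2) for d, with y = \<open>Im (w 0)\<close>
    the largest height.\<close>
  define C where "C = a\<^sup>2 * (4 * (Im (w 0) * Im (w 0))) / (1 - a\<^sup>2)"
  have "\<bar>Re (w (Suc n)) - Re (w n)\<bar> \<le> sqrt C" for n
  proof (rule real_le_rsqrt)
    let ?d = "(cmod (w (Suc n) - w n))\<^sup>2"
    have pos: "0 < Im (w m)" for m
      using orbit_in_halfplane by (simp add: upper_halfplane_def)
    have "(pseudo_hyp_dist (w n) (w (Suc n)))\<^sup>2 \<le> a\<^sup>2"
      using a(2) by (rule power_mono) (simp add: pseudo_hyp_dist_def)
    moreover have "0 < ?d + 4 * (Im (w (Suc n)) * Im (w n))"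
      using pos by (simp add: add_nonneg_pos)
    ultimately have "?d \<le> a\<^sup>2 * (?d + 4 * (Im (w (Suc n)) * Im (w n)))"
      by (simp add: pseudo_hyp_dist_def norm_divide power_divide cmod_minus_cnj_power2
          pos_divide_le_eq)
    also have "\<dots> \<le> a\<^sup>2 * (?d + 4 * (Im (w 0) * Im (w 0)))"
      using Im_orbit_bounds(2) pos by (intro mult_left_mono add_left_mono mult_mono) (auto intro: less_imp_le)
    finally have "?d \<le> C"
      using a2 by (simp add: C_def pos_le_divide_eq algebra_simps)
    moreover have "\<bar>Re (w (Suc n) - w n)\<bar>\<^sup>2 \<le> ?d"
      by (rule power_mono[OF abs_Re_le_cmod]) simp
    ultimately show "\<bar>Re (w (Suc n)) - Re (w n)\<bar>\<^sup>2 \<le> C" by simp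
  qed
  then show ?thesis by blast
qed

section \<open>Smallness of the displacement of \<open>\<phi>\<close>\<close>

text \<open>At \<open>w (Suc n)\<close> the displacement has imaginary part
  \<open>Im (w n) - Im (w (Suc n))\<close>, which tends to 0; Harnack carries this to the points of
  the line near the orbit.\<close>

lemma displacement_small_on_line:
  "\<exists>R. \<forall>x>R. Im (\<phi> (Complex x 1) - Complex x 1) < 1"
proof -
  obtain B where B: "\<And>n. \<bar>Re (w (Suc n)) - Re (w n)\<bar> \<le> B"
    using bounded_steps by blast
  \<comment> \<open>Bounds the separation of a point at height 1 from an orbit point at horizontal
    distance at most B: the vertical gap is at most 1 + \<open>Im (w 0)\<close>, and the heights are
    at least 1 and l.\<close>
  define T where "T = (B + (1 + Im (w 0)))\<^sup>2 / (1 * l)"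
  have T: "0 \<le> T" using height_pos by (simp add: T_def)
  have "(\<lambda>n. (2 + T) * (Im (w n) - Im (w (Suc n)))) \<longlonglongrightarrow> (2 + T) * (l - l)"
    by (intro tendsto_intros height_lim LIMSEQ_Suc)
  then have "\<forall>\<^sub>F n in sequentially. (2 + T) * (Im (w n) - Im (w (Suc n))) < 1"
    by (intro order_tendstoD) auto
  then obtain N where N: "\<And>n. n \<ge> N \<Longrightarrow> (2 + T) * (Im (w n) - Im (w (Suc n))) < 1"
    by (auto simp: eventually_sequentially)
  \<comment> \<open>Starting the search at \<open>Suc N\<close> ensures that the orbit point found
    has a predecessor of index at least N.\<close>
  have "Im (\<phi> (Complex x 1) - Complex x 1) < 1" if x: "x > Re (w (Suc N))" for x
  proof -
    obtain k where k: "k \<ge> Suc N" "\<bar>x - Re (w k)\<bar> \<le> B"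
      using exists_close_term[OF Re_lim B less_imp_le[OF x]] by blast
    obtain n where n: "k = Suc n" "n \<ge> N"
      using k(1) by (cases k) auto
    have v: "Complex x 1 \<in> upper_halfplane" by (simp add: upper_halfplane_def)
    have "cmod (Complex x 1 - w k) \<le> \<bar>x - Re (w k)\<bar> + \<bar>1 - Im (w k)\<bar>"
      using cmod_le[of "Complex x 1 - w k"] by simp
    also have "\<dots> \<le> B + (1 + Im (w 0))"
      using k(2) Im_orbit_bounds[of k] height_pos by auto
    finally have "hyp_sep (Complex x 1) (w k) \<le> T"
      unfolding T_def using height_pos Im_orbit_bounds by (intro hyp_sep_le) auto
    moreover have "Im (\<phi> (Complex x 1) - Complex x 1)
        \<le> (2 + hyp_sep (Complex x 1) (w k)) * (Im (w n) - Im (w (Suc n)))"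
      using pick_map_harnack[OF pick_map_displacement v orbit_in_halfplane[of k]]
      by (simp add: n orbit_step)
    ultimately have "Im (\<phi> (Complex x 1) - Complex x 1) \<le> (2 + T) * (Im (w n) - Im (w (Suc n)))"
      using height_decseq by (smt (verit) decseq_SucD mult_right_mono)
    then show ?thesis using N[OF n(2)] by simp
  qed
  then show ?thesis by blast
qed

section \<open>Convergence to the conjugating map\<close>

text \<open>
  Consecutive renormalised iterates compare \<open>\<phi>\<^sub>n\<close> at \<open>\<phi> (\<tau>\<^sub>n\<^sub>+\<^sub>1 z)\<close> and at \<open>\<tau>\<^sub>n z\<close>.  These two points
  coincide for \<open>z = \<i>\<close>, and in general their distance is controlled by the height drop
  \<open>Im (w n) - Im (w (Suc n))\<close>, which is summable.
\<close>
lemma conjugating_map_LIMSEQ: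
  assumes z: "z \<in> upper_halfplane"
  shows "(\<lambda>n. (\<phi> ^^ n) (renorm_map w n z)) \<longlonglongrightarrow> conjugating_map \<phi> w z"
proof -
  define t where "t = hyp_sep z \<i>"
  \<comment> \<open>Harnack bound for the heights of all renormalised iterates at z: each of them
    sends \<open>\<i>\<close> to \<open>w 0\<close>.\<close>
  define M where "M = (2 + t) * Im (w 0)"
  define D where "D = M / (l * Im z) * (cmod (z - \<i>) + (2 + t))"
  let ?\<psi> = "\<lambda>n. (\<phi> ^^ n) (renorm_map w n z)"
  have ii: "\<i> \<in> upper_halfplane" by (simp add: upper_halfplane_def)
  have Iz: "0 < Im z" using z by (simp add: upper_halfplane_def)
  have Iw: "0 < Im (w n)" for n using orbit_in_halfplane by (simp add: upper_halfplane_def)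
  have t: "0 \<le> t" unfolding t_def using z ii by (rule hyp_sep_nonneg)
  have M: "0 \<le> M" using t Iw[of 0] by (simp add: M_def)
  have ImM: "Im (?\<psi> n) \<le> M" for n
    using pick_map_harnack[OF pick_map_funpow_renorm[of n] z ii] funpow_orbit[of n 0]
    by (simp add: renorm_map_ii t_def M_def)
  have tau: "renorm_map w n z \<in> upper_halfplane" "l * Im z \<le> Im (renorm_map w n z)" for n
    using renorm_map_in_halfplane[OF z] Im_orbit_bounds Iz by (auto simp: Im_renorm_map)
  have bound: "norm (?\<psi> (Suc n) - ?\<psi> n) \<le> D * (Im (w n) - Im (w (Suc n)))" for n
  proof -
    define a b where "a = \<phi> (renorm_map w (Suc n) z)" and "b = renorm_map w n z"
    define p where "p v = \<phi> v - v" for v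
    let ?h = "Im (w n) - Im (w (Suc n))"
    have h: "0 \<le> ?h" using height_decseq by (simp add: decseq_Suc_iff)
    have "cmod (p (renorm_map w (Suc n) z) - p (w (Suc n))) \<le> (2 + t) * ?h"
    proof -
      have "hyp_sep (renorm_map w (Suc n) z) (w (Suc n)) = t"
        using hyp_sep_renorm_map[of w "Suc n" z \<i>] Iw[of "Suc n"] by (simp add: renorm_map_ii t_def)
      then show ?thesis
        using pick_map_cmod_diff_le[OF pick_map_displacement tau(1) orbit_in_halfplane, of "Suc n" "Suc n"]
        by (simp add: p_def orbit_step)
    qed
    \<comment> \<open>Each renormalised point is the orbit point plus its height times
      \<open>z - \<i>\<close>, and p at \<open>w (Suc n)\<close> equals
      \<open>w n - w (Suc n)\<close>, which cancels the orbit points.\<close>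
    moreover have "a - b = - (of_real ?h * (z - \<i>)) + (p (renorm_map w (Suc n) z) - p (w (Suc n)))"
      by (simp add: a_def b_def p_def orbit_step renorm_map_def complex_eq_iff algebra_simps)
    moreover have "cmod (of_real ?h * (z - \<i>)) = cmod (z - \<i>) * ?h"
      using h by (simp add: norm_mult del: of_real_diff)
    ultimately have ab: "cmod (a - b) \<le> (cmod (z - \<i>) + (2 + t)) * ?h"
      using norm_triangle_ineq[of "- (of_real ?h * (z - \<i>))" "p (renorm_map w (Suc n) z) - p (w (Suc n))"]
      by (simp add: distrib_right)
    have b: "b \<in> upper_halfplane" "l * Im z \<le> Im b"
      using tau by (auto simp: b_def)
    have a: "a \<in> upper_halfplane" "l * Im z \<le> Im a"
      using tau[of "Suc n"] maps parabolic_type_Im_ge[OF parabolic] by (auto simp: a_def intro: order_trans)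
    have \<psi>ab: "(\<phi> ^^ n) a = ?\<psi> (Suc n)" "(\<phi> ^^ n) b = ?\<psi> n"
      by (simp_all add: a_def b_def funpow_swap1)
    \<comment> \<open>Both values are images under the same iterate, so the Pick inequality turns
      the closeness of a and b into closeness of consecutive terms.\<close>
    have "(norm (?\<psi> (Suc n) - ?\<psi> n))\<^sup>2 \<le> hyp_sep a b * (Im (?\<psi> (Suc n)) * Im (?\<psi> n))"
      using pick_mapD[OF pick_map_funpow[of n] a(1) b(1)] by (simp only: \<psi>ab)
    also have "\<dots> \<le> ((cmod (a - b))\<^sup>2 / ((l * Im z) * (l * Im z))) * (M * M)"
      using height_pos Iz a b M ImM pick_map_Im_nonneg[OF pick_map_funpow_renorm z]
      by (intro mult_mono hyp_sep_le mult_pos_pos mult_nonneg_nonneg hyp_sep_nonneg)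
        (auto simp del: funpow.simps)
    also have "\<dots> = (M / (l * Im z) * cmod (a - b))\<^sup>2"
      by (simp add: power2_eq_square)
    finally have "norm (?\<psi> (Suc n) - ?\<psi> n) \<le> M / (l * Im z) * cmod (a - b)"
      by (rule power2_le_imp_le) (use M height_pos Iz in auto)
    also have "\<dots> \<le> M / (l * Im z) * ((cmod (z - \<i>) + (2 + t)) * ?h)"
      using ab M height_pos Iz by (intro mult_left_mono) auto
    finally show ?thesis by (simp add: D_def)
  qed
  have "summable (\<lambda>n. D * (Im (w n) - Im (w (Suc n))))"
    by (intro summable_mult telescope_summable'[OF height_lim])
  then have "summable (\<lambda>n. ?\<psi> (Suc n) - ?\<psi> n)"
    by (rule summable_comparison_test') (rule bound)
  then have "convergent (\<lambda>n. (\<Sum>k<n. ?\<psi> (Suc k) - ?\<psi> k) + ?\<psi> 0)"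
    by (intro convergent_add convergent_const) (simp add: summable_iff_convergent)
  then have "convergent ?\<psi>"
    using sum_lessThan_telescope[of ?\<psi>] by (simp only: diff_add_cancel)
  then show ?thesis
    by (simp add: conjugating_map_def convergent_LIMSEQ_iff)
qed

lemma renorm_displacement_LIMSEQ:
  assumes "z \<in> upper_halfplane"
  shows "(\<lambda>n. (\<phi> ^^ n) (renorm_map w n z) - of_real (Im (w n)) * z)
    \<longlonglongrightarrow> conjugating_map \<phi> w z - of_real l * z"
  by (intro tendsto_intros conjugating_map_LIMSEQ assms height_lim)

lemma pick_map_conjugating_displacement: "pick_map (\<lambda>z. conjugating_map \<phi> w z - of_real l * z)"
  using pick_map_renorm_displacement renorm_displacement_LIMSEQ by (rule pick_map_limit)

section \<open>Smallness of the displacement of the conjugating map\<close>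

text \<open>
  At the point \<open>v\<close> with \<open>\<tau>\<^sub>n v = w (n + k)\<close> the imaginary part of \<open>\<phi>\<^sub>n (\<tau>\<^sub>n v) - y\<^sub>n v\<close> is
  \<open>y\<^sub>k - y\<^sub>n\<^sub>+\<^sub>k\<close>, which is small for large \<open>k\<close> uniformly in \<open>n\<close>.
\<close>
lemma conjugating_displacement_small_on_line:
  "\<exists>R. \<forall>x>R. Im (conjugating_map \<phi> w (Complex x 1) - of_real l * Complex x 1) < l"
proof -
  obtain B where B: "\<And>n. \<bar>Re (w (Suc n)) - Re (w n)\<bar> \<le> B"
    using bounded_steps by blast
  have B0: "0 \<le> B" using B[of 0] by linarith
  have iter: "\<bar>Re (w (n + k)) - Re (w n)\<bar> \<le> real k * B" for n k
  proof (induction k)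
    case (Suc k)
    then show ?case using B[of "n + k"] by (simp add: algebra_simps)
  qed simp
  define T where "T = (B + Im (w 0))\<^sup>2 / (l * l)"
  have T: "0 \<le> T" using height_pos by (simp add: T_def)
  have "(\<lambda>n. (2 + T) * (Im (w n) - l)) \<longlonglongrightarrow> (2 + T) * (l - l)"
    by (intro tendsto_intros height_lim)
  then have "\<forall>\<^sub>F n in sequentially. (2 + T) * (Im (w n) - l) < l"
    using height_pos by (intro order_tendstoD) auto
  then obtain K where K: "(2 + T) * (Im (w K) - l) < l"
    by (auto simp: eventually_sequentially)
  \<comment> \<open>In K steps the orbit moves right by at most K B, and renormalisation scales x by
    at least l. This threshold thus places the renormalised point beyond \<open>w (n + K)\<close>
    for every n at once.\<close>
  have "Im (conjugating_map \<phi> w (Complex x 1) - of_real l * Complex x 1) < l"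
    if x: "x > real K * B / l" for x
  proof -
    let ?c = "Complex x 1"
    have c: "?c \<in> upper_halfplane" by (simp add: upper_halfplane_def)
    have "Im ((\<phi> ^^ n) (renorm_map w n ?c) - of_real (Im (w n)) * ?c) \<le> (2 + T) * (Im (w K) - l)" for n
    proof -
      have Iw: "0 < Im (w m)" for m using orbit_in_halfplane by (simp add: upper_halfplane_def)
      have "0 \<le> real K * B / l"
        using height_pos B0 by simp
      then have "0 \<le> x" "real K * B \<le> l * x"
        using x height_pos by (linarith, simp add: field_simps)
      then have "real K * B \<le> Im (w n) * x"
        using Im_orbit_bounds(1)[of n] by (meson mult_right_mono order_trans)
      then have start: "Re (w (n + K)) \<le> Re (w n) + Im (w n) * x"
        using iter[of n K] by linarith
      obtain j where j: "j \<ge> n + K" "\<bar>Re (w n) + Im (w n) * x - Re (w j)\<bar> \<le> B"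
        using exists_close_term[OF Re_lim B start] by blast
      obtain k where k: "j = n + k" "K \<le> k"
        using j(1) by (metis add_le_cancel_left le_trans nat_le_iff_add)
      \<comment> \<open>The preimage of \<open>w j\<close> under the renormalisation; isometry
        transfers the separation bound from \<open>w j\<close> to v.\<close>
      define v where "v = (w j - of_real (Re (w n))) / of_real (Im (w n))"
      have tv: "renorm_map w n v = w j"
        using Iw[of n] by (simp add: v_def renorm_map_def)
      have Iv: "Im (w n) * Im v = Im (w j)"
        using tv Im_renorm_map by metis
      then have v: "v \<in> upper_halfplane"
        using Iw[of n] Iw[of j] by (simp add: upper_halfplane_def) (metis zero_less_mult_pos)
      have "cmod (renorm_map w n ?c - w j) \<le> \<bar>Re (w n) + Im (w n) * x - Re (w j)\<bar> + \<bar>Im (w n) - Im (w j)\<bar>"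
        using cmod_le[of "renorm_map w n ?c - w j"] by (simp add: renorm_map_def)
      also have "\<dots> \<le> B + Im (w 0)"
        using j(2) Im_orbit_bounds(2)[of n] Im_orbit_bounds(2)[of j] Iw[of n] Iw[of j] by (simp add: abs_if)
      finally have "hyp_sep (renorm_map w n ?c) (w j) \<le> T"
        unfolding T_def using height_pos Im_orbit_bounds by (intro hyp_sep_le) (auto simp: Im_renorm_map)
      then have sep: "hyp_sep ?c v \<le> T"
        using hyp_sep_renorm_map[of w n ?c v] Iw[of n] by (simp add: tv)
      have val: "Im ((\<phi> ^^ n) (renorm_map w n v) - of_real (Im (w n)) * v) = Im (w k) - Im (w j)"
        by (simp add: tv Iv) (simp add: k funpow_orbit)
      have "Im ((\<phi> ^^ n) (renorm_map w n ?c) - of_real (Im (w n)) * ?c)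
          \<le> (2 + hyp_sep ?c v) * (Im (w k) - Im (w j))"
        using pick_map_harnack[OF pick_map_renorm_displacement c v, of n] by (simp only: val)
      \<comment> \<open>From K <= k and \<open>Im (w j)\<close> >= l comes a bound free of n, which
        therefore survives the limit.\<close>
      also have "\<dots> \<le> (2 + T) * (Im (w K) - l)"
        using sep hyp_sep_nonneg[OF c v] T Im_orbit_bounds(1)[of j] Im_orbit_bounds(1)[of K]
          decseqD[OF height_decseq k(2)] decseqD[OF height_decseq, of k j] k(1)
        by (intro mult_mono) auto
      finally show ?thesis .
    qed
    then have "Im (conjugating_map \<phi> w ?c - of_real l * ?c) \<le> (2 + T) * (Im (w K) - l)"
      by (intro LIMSEQ_le_const2[OF tendsto_Im[OF renorm_displacement_LIMSEQ[OF c]]]) blast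
    then show ?thesis using K by simp
  qed
  then show ?thesis by blast
qed

section \<open>Injectivity on far quadrants\<close>

lemma inj_on_quadrant:
  "\<exists>R0. \<forall>R\<ge>R0. inj_on (conjugating_map \<phi> w) (quadrant R) \<and> inj_on \<phi> (quadrant R)"
proof -
  obtain R1 where R1: "\<And>x. x > R1 \<Longrightarrow>
      Im (conjugating_map \<phi> w (Complex x 1) - of_real l * Complex x 1) < l"
    using conjugating_displacement_small_on_line by blast
  obtain R2 where R2: "\<And>x. x > R2 \<Longrightarrow> Im (\<phi> (Complex x 1) - Complex x 1) < 1"
    using displacement_small_on_line by blast
  have sub: "quadrant R \<subseteq> upper_halfplane" for R
    by (auto simp: quadrant_def upper_halfplane_def)
  have "inj_on (\<lambda>z. of_real l * z + (conjugating_map \<phi> w z - of_real l * z)) (quadrant R1)"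
    using pick_map_conjugating_displacement height_pos sub
      pick_map_Im_less_on_quadrant[OF pick_map_conjugating_displacement R1]
    by (rule inj_on_linear_plus_pick_map)
  moreover have "inj_on (\<lambda>z. of_real 1 * z + (\<phi> z - z)) (quadrant R2)"
    using pick_map_displacement zero_less_one sub
      pick_map_Im_less_on_quadrant[OF pick_map_displacement R2]
    by (rule inj_on_linear_plus_pick_map)
  moreover have "quadrant R \<subseteq> quadrant R1 \<inter> quadrant R2" if "R \<ge> max R1 R2" for R
    using that by (auto simp: quadrant_def)
  ultimately show ?thesis
    by (intro exI[of _ "max R1 R2"]) (auto intro: inj_on_subset)
qed

end

theorem corollary1p17:
  fixes \<phi> :: "complex \<Rightarrow> complex" and w :: "nat \<Rightarrow> complex"
  assumes "parabolic_type \<phi>"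
    and "backward_iteration_bounded_steps \<phi> w"
    and "filterlim w at_infinity sequentially"
    and "nonzero_height w"
    and "filterlim (\<lambda>n. Re (w n)) at_top sequentially"
  shows "\<exists>R0. \<forall>R\<ge>R0.
           inj_on (conjugating_map \<phi> w) (quadrant R) \<and> inj_on \<phi> (quadrant R)"
proof -
  obtain l where "decseq (\<lambda>n. Im (w n))" "0 < l" "(\<lambda>n. Im (w n)) \<longlonglongrightarrow> l"
    using assms(4) by (auto simp: nonzero_height_def)
  then interpret parabolic_backward_orbit \<phi> w l
    using assms by unfold_locales
  show ?thesis by (rule inj_on_quadrant)
qed

end
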